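(* Let $m=(m_0,m_1,\dots)$ be an arbitrary (bounded or unbounded) sequence of integers with $m_k\ge 2$ for all $k$, let $G_m$ be the associated Vilenkin group, let $H_1=H_1(G_m)$ be the atomic Hardy space on $G_m$, and let $S_kf$ denote the $k$-th partial sum of the Vilenkin–Fourier series of $f$. Then there exists a function $f\in H_1$ such that $$\sup_{n\in\mathbb{N}_+}\ \frac{1}{n}\sum_{k=1}^{n}\|S_kf\|_1=\infty .$$
   Context: $\mathbb{N}_+$ is the set of positive integers and $\mathbb{N}=\mathbb{N}_+\cup\{0\}$. Vilenkin group. For a sequence $m=(m_0,m_1,\dots)$ of integers $m_k\ge 2$, let $Z_{m_k}=\{0,1,\dots,m_k-1\}$ be the additive group of integers modulo $m_k$ with the discrete topology, and let $G_m=\prod_{k=0}^\infty Z_{m_k}$ be the complete direct product with the product topology. Its elements are sequences $x=(x_0,x_1,\dots)$ with $x_k\in Z_{m_k}$. Let $\mu$ be the normalized Haar measure on $G_m$, i.e. the product of the uniform probability measures on the $Z_{m_k}$. The norm $\|\cdot\|_1$ is that of $L_1(G_m)=L_1(G_m,\mu)$ (complex-valued functions). Vilenkin system. Put $M_0=1$, $M_{k+1}=m_kM_k$. Every $n\in\mathbb{N}$ is uniquely $n=\sum_{j\ge0}n_jM_j$ with $n_j\in Z_{m_j}$, only finitely many $n_j$ nonzero. Let $r_k(x)=\exp(2\pi i x_k/m_k)$ and $\psi_n(x)=\prod_{k=0}^\infty r_k(x)^{n_k}$. For $f\in L_1(G_m)$ put $\widehat f(k)=\int_{G_m}f\,\overline{\psi_k}\,d\mu$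 for $k\in\mathbb{N}$, and $S_nf=\sum_{k=0}^{n-1}\widehat f(k)\psi_k$ for $n\in\mathbb{N}_+$. Intervals. For $x\in G_m$, $n\in\mathbb{N}$, $k\in Z_{m_n}$ let $I_n(x,k)=\{y\in G_m: y_0=x_0,\dots,y_{n-1}=x_{n-1},\ y_n=k\}$. A set $I\subset G_m$ is an interval if $I=\bigcup_{k\in U}I_n(x,k)$ for some $x\in G_m$, $n\in\mathbb{N}$ and some $U\subset Z_{m_n}$ obtained from $Z_{m_n}$ by dyadic partition. This means that $U$ belongs to the smallest family of subsets of $Z_{m_n}$ which contains $Z_{m_n}$ itself and which, with every block $\{a,a+1,\dots,a+\ell-1\}$ of $\ell\ge2$ consecutive elements in it, also contains the two blocks $\{a,\dots,a+\lfloor \ell/2\rfloor-1\}$ and $\{a+\lfloor \ell/2\rfloor,\dots,a+\ell-1\}$. Write $|I|=\mu(I)$. Hardy space. A function $a\in L^\infty(G_m)$ is an atom if either $a\equiv1$, or there is an interval $I$ such that $\operatorname{supp}a\subset I$, $|a|\le|I|^{-1}$ and $\int_I a\,d\mu=0$. The space $H_1(G_m)$ consists of all functions $f=\sum_{i=0}^\infty\lambda_ia_i$ (convergence in $L_1(G_m)$), where the $a_i$ are atoms and the $\lambda_i$ are complex numbers with $\sum_{i=0}^\infty|\lambda_i|<\infty$. It is normed by $\|f\|_{H_1}=\inf\sum_{i=0}^\infty|\lambda_i|$, the infimum being over all such decompositions of $f$. In particular $H_1(G_m)\subset L_1(G_m)$. *)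

theory Defs
  imports "HOL-Probability.Probability"
begin

section \<open>The Vilenkin group\<close>

text \<open>
  An element of \<open>G_m\<close> is a function \<open>x :: nat \<Rightarrow> nat\<close> with \<open>x k < m k\<close> for all \<open>k\<close>, so
  \<open>G_m\<close> is the space of the measure below. As the factors are finite and discrete and the
  product is countable, the product sigma-algebra is the Borel sigma-algebra of the product
  topology, and the product of the uniform measures is the normalized Haar measure.
\<close>

definition haar :: "(nat \<Rightarrow> nat) \<Rightarrow> (nat \<Rightarrow> nat) measure" where
  "haar m = Pi\<^sub>M UNIV (\<lambda>k. uniform_count_measure {..<m k})"

lemma space_haar: "space (haar m) = {x. \<forall>k. x k < m k}"
  by (auto simp: haar_def space_PiM space_uniform_count_measure)

lemma prob_space_haar:
  assumes "\<And>k. 2 \<le> m k"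
  shows "prob_space (haar m)"
proof -
  have "{..<m k} \<noteq> {}" for k
    using assms[of k] by (auto simp: lessThan_empty_iff)
  then show ?thesis
    unfolding haar_def by (intro prob_space_PiM prob_space_uniform_count_measure) auto
qed

definition L1_norm :: "(nat \<Rightarrow> nat) \<Rightarrow> ((nat \<Rightarrow> nat) \<Rightarrow> complex) \<Rightarrow> real" where
  "L1_norm m f = (LINT x|haar m. norm (f x))"

section \<open>The Vilenkin system\<close>

fun vilenkin_M :: "(nat \<Rightarrow> nat) \<Rightarrow> nat \<Rightarrow> nat" where
  "vilenkin_M m 0 = 1"
| "vilenkin_M m (Suc k) = m k * vilenkin_M m k"

text \<open>
  The digits of \<open>n\<close> are given by an explicit formula; \<open>digit_expansion\<close> and \<open>digit_unique\<close>
  show that they are the coefficients of the unique expansion of \<open>n\<close> along \<open>vilenkin_M m\<close>.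
\<close>

definition digit :: "(nat \<Rightarrow> nat) \<Rightarrow> nat \<Rightarrow> nat \<Rightarrow> nat" where
  "digit m n j = (n div vilenkin_M m j) mod m j"

lemma vilenkin_M_gt:
  assumes "\<And>k. 2 \<le> m k"
  shows "k < vilenkin_M m k"
proof (induction k)
  case (Suc k)
  have "Suc k < 2 * vilenkin_M m k"
    using Suc by linarith
  also have "\<dots> \<le> m k * vilenkin_M m k"
    using assms by (rule mult_le_mono1)
  finally show ?case
    by simp
qed simp

lemma digit_less:
  assumes "\<And>k. 2 \<le> m k"
  shows "digit m n j < m j"
  using assms[of j] by (simp add: digit_def)

lemma digit_eq_0:
  assumes "\<And>k. 2 \<le> m k" and "n \<le> j"
  shows "digit m n j = 0"
  using vilenkin_M_gt[of m j, OF assms(1)] assms(2) by (simp add: digit_def)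

lemma digits_subset:
  assumes "\<And>k. 2 \<le> m k"
  shows "{j. digit m n j \<noteq> 0} \<subseteq> {..<n}"
proof
  fix j assume "j \<in> {j. digit m n j \<noteq> 0}"
  then show "j \<in> {..<n}"
    using digit_eq_0[OF assms, of n j] by (cases "j < n") auto
qed

lemma finite_digits:
  assumes "\<And>k. 2 \<le> m k"
  shows "finite {j. digit m n j \<noteq> 0}"
  using digits_subset[OF assms] by (rule finite_subset) simp

lemma sum_digits_mod: "(\<Sum>j<N. digit m n j * vilenkin_M m j) = n mod vilenkin_M m N"
proof (induction N)
  case (Suc N)
  have "n mod vilenkin_M m (Suc N)
      = vilenkin_M m N * (n div vilenkin_M m N mod m N) + n mod vilenkin_M m N"
    unfolding vilenkin_M.simps mult.commute[of "m N"] by (rule mod_mult2_eq)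
  with Suc show ?case
    by (simp add: digit_def)
qed simp

lemma digit_expansion:
  assumes "\<And>k. 2 \<le> m k"
  shows "n = (\<Sum>j | digit m n j \<noteq> 0. digit m n j * vilenkin_M m j)"
proof -
  have "(\<Sum>j | digit m n j \<noteq> 0. digit m n j * vilenkin_M m j)
      = (\<Sum>j<n. digit m n j * vilenkin_M m j)"
  proof (rule sum.mono_neutral_left)
    show "{j. digit m n j \<noteq> 0} \<subseteq> {..<n}"
      using assms by (rule digits_subset)
  qed auto
  also have "\<dots> = n"
    using vilenkin_M_gt[of m n, OF assms] by (simp add: sum_digits_mod)
  finally show ?thesis
    by simp
qed

lemma digit_unique:
  assumes m: "\<And>k. 2 \<le> m k" and d: "\<And>j. d j < m j" and fin: "finite {j. d j \<noteq> 0}"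
    and n: "n = (\<Sum>j | d j \<noteq> 0. d j * vilenkin_M m j)"
  shows "d = digit m n"
proof
  fix i
  let ?M = "vilenkin_M m"
  have less: "(\<Sum>j<N. d j * ?M j) < ?M N" for N
  proof (induction N)
    case (Suc N)
    have "(\<Sum>j<Suc N. d j * ?M j) < Suc (d N) * ?M N"
      using Suc by simp
    also have "\<dots> \<le> ?M (Suc N)"
      using d[of N] mult_le_mono1[of "Suc (d N)" "m N" "?M N"] by simp
    finally show ?case .
  qed simp
  have dvd: "?M i dvd ?M (i + k)" for i k
    by (induction k) auto
  obtain N where N: "{j. d j \<noteq> 0} \<subseteq> {..<N}"
    using fin unfolding finite_nat_iff_bounded by blast
  define K where "K = Suc (N + i)"
  have "n = (\<Sum>j<K. d j * ?M j)"
    unfolding n using N by (intro sum.mono_neutral_left) (auto simp: K_def)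
  also have "{..<K} = {..<Suc i} \<union> {Suc i..<K}"
    by (auto simp: K_def)
  also have "(\<Sum>j\<in>{..<Suc i} \<union> {Suc i..<K}. d j * ?M j)
      = (\<Sum>j<Suc i. d j * ?M j) + (\<Sum>j\<in>{Suc i..<K}. d j * ?M j)"
    by (rule sum.union_disjoint) auto
  finally have split: "n = \<dots>" .
  have "?M (Suc i) dvd (\<Sum>j\<in>{Suc i..<K}. d j * ?M j)"
  proof (rule dvd_sum)
    fix j assume "j \<in> {Suc i..<K}"
    then have "?M (Suc i) dvd ?M j"
      using dvd[of "Suc i" "j - Suc i"] by simp
    then show "?M (Suc i) dvd d j * ?M j"
      by (rule dvd_mult)
  qed
  then obtain c where c: "(\<Sum>j\<in>{Suc i..<K}. d j * ?M j) = ?M (Suc i) * c"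
    by (elim dvdE)
  have "n = (\<Sum>j<i. d j * ?M j) + ?M i * (d i + m i * c)"
    using split unfolding c by (simp add: algebra_simps)
  moreover have "0 < ?M i"
    using vilenkin_M_gt[of m i, OF m] by simp
  ultimately have "n div ?M i = d i + m i * c"
    using less[of i] by simp
  then show "d i = digit m n i"
    using d[of i] by (simp add: digit_def)
qed

definition rademacher :: "(nat \<Rightarrow> nat) \<Rightarrow> nat \<Rightarrow> (nat \<Rightarrow> nat) \<Rightarrow> complex" where
  "rademacher m k x = exp (2 * of_real pi * \<i> * of_nat (x k) / of_nat (m k))"

text \<open>The infinite product has only finitely many nontrivial factors, by \<open>finite_digits\<close>.\<close>

definition vilenkin_psi :: "(nat \<Rightarrow> nat) \<Rightarrow> nat \<Rightarrow> (nat \<Rightarrow> nat) \<Rightarrow> complex" where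
  "vilenkin_psi m n x = (\<Prod>k | digit m n k \<noteq> 0. rademacher m k x ^ digit m n k)"

definition fourier_coeff :: "(nat \<Rightarrow> nat) \<Rightarrow> ((nat \<Rightarrow> nat) \<Rightarrow> complex) \<Rightarrow> nat \<Rightarrow> complex" where
  "fourier_coeff m f k = (LINT x|haar m. f x * cnj (vilenkin_psi m k x))"

definition partial_sum ::
  "(nat \<Rightarrow> nat) \<Rightarrow> nat \<Rightarrow> ((nat \<Rightarrow> nat) \<Rightarrow> complex) \<Rightarrow> (nat \<Rightarrow> nat) \<Rightarrow> complex" where
  "partial_sum m n f x = (\<Sum>k<n. fourier_coeff m f k * vilenkin_psi m k x)"

section \<open>The atomic Hardy space\<close>

inductive_set dyadic_blocks :: "nat \<Rightarrow> nat set set" for q :: nat where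
  whole: "{..<q} \<in> dyadic_blocks q"
| left: "{a..<a + l} \<in> dyadic_blocks q \<Longrightarrow> 2 \<le> l \<Longrightarrow> {a..<a + l div 2} \<in> dyadic_blocks q"
| right: "{a..<a + l} \<in> dyadic_blocks q \<Longrightarrow> 2 \<le> l \<Longrightarrow> {a + l div 2..<a + l} \<in> dyadic_blocks q"

definition cell :: "(nat \<Rightarrow> nat) \<Rightarrow> nat \<Rightarrow> (nat \<Rightarrow> nat) \<Rightarrow> nat \<Rightarrow> (nat \<Rightarrow> nat) set" where
  "cell m n x k = {y \<in> space (haar m). (\<forall>i<n. y i = x i) \<and> y n = k}"

definition interval :: "(nat \<Rightarrow> nat) \<Rightarrow> (nat \<Rightarrow> nat) set \<Rightarrow> bool" where
  "interval m I \<longleftrightarrow>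
    (\<exists>x\<in>space (haar m). \<exists>n. \<exists>U\<in>dyadic_blocks (m n). I = (\<Union>k\<in>U. cell m n x k))"

lemma finite_dyadic_block: "U \<in> dyadic_blocks q \<Longrightarrow> finite U"
  by (induction rule: dyadic_blocks.induct) auto

lemma measurable_coord: "{y \<in> space (haar m). y i = k} \<in> sets (haar m)"
proof -
  let ?u = "\<lambda>k. uniform_count_measure {..<m k}"
  have "(\<lambda>y. y i) \<in> measurable (haar m) (?u i)"
    unfolding haar_def by (rule measurable_component_singleton) simp
  then have "(\<lambda>y. y i) -` ({k} \<inter> {..<m i}) \<inter> space (haar m) \<in> sets (haar m)"
    by (rule measurable_sets) (auto simp: sets_uniform_count_measure)
  moreover have "(\<lambda>y. y i) -` ({k} \<inter> {..<m i}) \<inter> space (haar m)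
      = {y \<in> space (haar m). y i = k}"
    by (auto simp: space_haar)
  ultimately show ?thesis
    by simp
qed

lemma cell_in_sets: "cell m n x k \<in> sets (haar m)"
proof -
  let ?A = "\<lambda>i. {y \<in> space (haar m). y i = (if i < n then x i else k)}"
  have "y \<in> cell m n x k \<longleftrightarrow> (\<forall>i\<in>{..n}. y \<in> ?A i)" for y
  proof -
    have "(\<forall>i\<in>{..n}. y \<in> ?A i) \<longleftrightarrow> y \<in> ?A n \<and> (\<forall>i<n. y \<in> ?A i)"
      by (simp only: Ball_def atMost_iff le_less) blast
    then show ?thesis
      unfolding cell_def by (simp add: conj_commute) blast
  qed
  then have "cell m n x k = (\<Inter>i\<in>{..n}. ?A i)"
    by (simp only: set_eq_iff INT_iff simp_thms)
  moreover have "(\<Inter>i\<in>{..n}. ?A i) \<in> sets (haar m)"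
    by (rule sets.finite_INT) (rule finite_atMost, simp, rule measurable_coord)
  ultimately show ?thesis
    by (simp only:)
qed

lemma interval_in_sets:
  assumes "interval m I"
  shows "I \<in> sets (haar m)"
proof -
  obtain x n U where "U \<in> dyadic_blocks (m n)" and I: "I = (\<Union>k\<in>U. cell m n x k)"
    using assms unfolding interval_def by blast
  then have "finite U"
    by (simp only: finite_dyadic_block)
  then show ?thesis
    unfolding I by (rule sets.finite_UN) (rule cell_in_sets)
qed

definition L_infinity :: "(nat \<Rightarrow> nat) \<Rightarrow> ((nat \<Rightarrow> nat) \<Rightarrow> complex) set" where
  "L_infinity m = {a \<in> borel_measurable (haar m). \<exists>C. AE x in haar m. norm (a x) \<le> C}"

text \<open>
  Elements of \<open>L\<^sup>\<infinity>\<close> are represented by functions, so the pointwise conditions on an atom are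
  required almost everywhere. Intervals are closed, hence the support of \<open>a\<close> is contained in \<open>I\<close>
  iff \<open>a\<close> vanishes almost everywhere off \<open>I\<close>.
\<close>

definition atom :: "(nat \<Rightarrow> nat) \<Rightarrow> ((nat \<Rightarrow> nat) \<Rightarrow> complex) \<Rightarrow> bool" where
  "atom m a \<longleftrightarrow> a \<in> L_infinity m \<and>
    ((AE x in haar m. a x = 1) \<or>
     (\<exists>I. interval m I \<and>
          (AE x in haar m. x \<notin> I \<longrightarrow> a x = 0) \<and>
          (AE x in haar m. norm (a x) \<le> 1 / measure (haar m) I) \<and>
          (LINT x:I|haar m. a x) = 0))"

definition H1 :: "(nat \<Rightarrow> nat) \<Rightarrow> ((nat \<Rightarrow> nat) \<Rightarrow> complex) set" where
  "H1 m = {f. integrable (haar m) f \<and>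
    (\<exists>(c :: nat \<Rightarrow> complex) a. (\<forall>i. atom m (a i)) \<and> summable (\<lambda>i. norm (c i)) \<and>
       (\<lambda>N. L1_norm m (\<lambda>x. f x - (\<Sum>i<N. c i * a i x))) \<longlonglongrightarrow> 0)}"

end

theory Submission
  imports Defs
begin

text \<open>
  Let \<open>I\<^sub>s\<close> be the set of \<open>x\<close> whose first \<open>s\<close> coordinates vanish. The function
  \<open>M\<^sub>N 1\<^bsub>I\<^sub>N\<^esub> r\<^sub>N\<close> is an atom for every \<open>m\<close>, since \<open>I\<^sub>N\<close> is an interval whose block is all of
  \<open>Z\<^bsub>m\<^sub>N\<^esub>\<close>; it equals \<open>\<Sum>\<psi>\<^sub>l\<close> over \<open>M\<^sub>N \<le> l < 2M\<^sub>N\<close>. Now let \<open>f\<close> have all Fourier coefficients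
  with indices in \<open>[M\<^sub>N, 2M\<^sub>N)\<close> equal to \<open>c\<close>, and let \<open>x \<in> I\<^sub>s\<close> with \<open>1 \<le> s \<le> N\<close>. Within a block of \<open>M\<^sub>s\<close>
  indices the characters agree at \<open>x\<close>, so \<open>S\<^sub>k f(x)\<close> is an arithmetic progression in \<open>k\<close> with step
  of modulus \<open>|c|\<close>; pairing terms half a block apart shows that \<open>|S\<^sub>k f(x)|\<close> is at least of order
  \<open>|c| M\<^sub>s\<close> on average. As the \<open>M\<^sub>s\<close> grow geometrically, the average over \<open>[M\<^sub>N, 2M\<^sub>N)\<close> dominates
  \<open>|c| \<Sum>\<^bsub>1\<le>s\<le>N\<^esub> M\<^sub>s 1\<^bsub>I\<^sub>s\<^esub>\<close> up to a constant, and the integral of this function is \<open>|c| N\<close>.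
  The spectra of the atoms are disjoint, so \<open>f = \<Sum>\<^sub>j 2\<^sup>-\<^sup>j M\<^sub>N 1\<^bsub>I\<^sub>N\<^esub> r\<^sub>N\<close> with \<open>N = 4\<^sup>j\<close> has averages at
  least of order \<open>2\<^sup>-\<^sup>j 4\<^sup>j = 2\<^sup>j\<close>.
\<close>

section \<open>Elementary facts on finite products and sums\<close>

lemma borel_measurable_uniform_count_measure:
  "g \<in> borel_measurable (uniform_count_measure A)"
  by (simp add: measurable_cong_sets[OF sets_uniform_count_measure_count_space refl])

lemma prod_of_bool:
  fixes P :: "nat \<Rightarrow> bool"
  shows "(\<Prod>i<n. of_bool (P i)) = (of_bool (\<forall>i<n. P i) :: 'a::comm_semiring_1)"
  by (induction n) (auto simp: less_Suc_eq)

lemma sum_lessThan_add: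
  fixes f :: "nat \<Rightarrow> 'a::comm_monoid_add"
  shows "(\<Sum>i<a + b. f i) = (\<Sum>i<a. f i) + (\<Sum>i<b. f (a + i))"
  by (induction b) (simp_all add: add.assoc)

lemma sum_atLeastLessThan_shift:
  fixes f :: "nat \<Rightarrow> 'a::comm_monoid_add"
  shows "sum f {a..<a + b} = (\<Sum>i<b. f (a + i))"
  by (induction b) simp_all

text \<open>With \<open>h = n div 2\<close>, the terms with indices \<open>a\<close> and
  \<open>h + a\<close> differ by \<open>h * v\<close>, so the triangle inequality bounds each of the
  \<open>h\<close> pairs below by \<open>h * norm v\<close>.\<close>

lemma sum_norm_affine_ge:
  fixes u v :: "'a::real_normed_field"
  assumes "2 \<le> n"
  shows "(real n)\<^sup>2 / 9 * norm v \<le> (\<Sum>a<n. norm (u + of_nat a * v))"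
proof -
  define h where "h = n div 2"
  \<comment> \<open>Equality occurs at \<open>n = 3\<close>; squaring this bound produces the
    constant 9.\<close>
  have "n \<le> 3 * h"
    using assms unfolding h_def by presburger
  then have "real n / 3 \<le> real h"
    by simp
  then have "(real n / 3)\<^sup>2 \<le> (real h)\<^sup>2"
    by (intro power_mono) auto
  then have "(real n)\<^sup>2 / 9 * norm v \<le> (real h)\<^sup>2 * norm v"
    by (intro mult_right_mono) (auto simp: power_divide)
  also have "\<dots> = (\<Sum>a<h. norm (of_nat h * v))"
    by (simp add: power2_eq_square norm_mult)
  also have "\<dots> \<le> (\<Sum>a<h. norm (u + of_nat a * v) + norm (u + of_nat (h + a) * v))"
  proof (rule sum_mono)
    fix a
    have "of_nat h * v = (u + of_nat (h + a) * v) - (u + of_nat a * v)"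
      by (simp add: algebra_simps)
    then show "norm (of_nat h * v) \<le> norm (u + of_nat a * v) + norm (u + of_nat (h + a) * v)"
      using norm_triangle_ineq4 by (metis add.commute)
  qed
  also have "\<dots> = (\<Sum>a<h + h. norm (u + of_nat a * v))"
    by (simp only: sum.distrib sum_lessThan_add)
  also have "\<dots> \<le> (\<Sum>a<n. norm (u + of_nat a * v))"
    by (rule sum_mono2) (auto simp: h_def)
  finally show ?thesis .
qed

section \<open>Integration of coordinate functions\<close>

locale vilenkin =
  fixes m :: "nat \<Rightarrow> nat"
  assumes m_ge_2: "\<And>k. 2 \<le> m k"
begin

lemma m_pos: "0 < m k"
  using m_ge_2[of k] by simp

sublocale prob_space "haar m"
  by (rule prob_space_haar) (rule m_ge_2)

lemma coord_prob_space: "prob_space (uniform_count_measure {..<m i})"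
  by (intro prob_space_uniform_count_measure) (use m_pos in auto)

lemma measurable_coord_haar:
  "(\<lambda>x. x i) \<in> measurable (haar m) (uniform_count_measure {..<m i})"
  unfolding haar_def by (rule measurable_component_singleton) simp

lemma measurable_coord_fun:
  "(\<lambda>x. g (x i)) \<in> borel_measurable (haar m)"
  by (rule measurable_compose[OF measurable_coord_haar])
     (rule borel_measurable_uniform_count_measure)

lemma indep_coords: "indep_vars (\<lambda>i. uniform_count_measure {..<m i}) (\<lambda>i x. x i) UNIV"
proof (subst indep_vars_iff_distr_eq_PiM')
  show "distr (haar m) (\<Pi>\<^sub>M i\<in>UNIV. uniform_count_measure {..<m i}) (\<lambda>x. \<lambda>i\<in>UNIV. x i)
    = (\<Pi>\<^sub>M i\<in>UNIV. distr (haar m) (uniform_count_measure {..<m i}) (\<lambda>x. x i))"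
    unfolding haar_def
    by (subst distr_PiM_component[OF coord_prob_space]) (simp_all add: distr_id2 restrict_UNIV)
qed (auto intro: measurable_coord_haar)

lemma integral_coord:
  fixes g :: "nat \<Rightarrow> 'b::{real_normed_field,banach,second_countable_topology}"
  shows "(LINT x|haar m. g (x i)) = (\<Sum>t<m i. g t) / of_nat (m i)"
proof -
  have "(LINT x|haar m. g (x i)) = (LINT t|distr (haar m) (uniform_count_measure {..<m i}) (\<lambda>x. x i). g t)"
    by (rule integral_distr[symmetric, OF measurable_coord_haar])
       (rule borel_measurable_uniform_count_measure)
  also have "distr (haar m) (uniform_count_measure {..<m i}) (\<lambda>x. x i) = uniform_count_measure {..<m i}"
    unfolding haar_def by (rule distr_PiM_component[OF coord_prob_space]) simp
  also have "(LINT t|uniform_count_measure {..<m i}. g t) = (\<Sum>t<m i. g t) / of_nat (m i)"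
    by (simp add: uniform_count_measure_def lebesgue_integral_point_measure_finite
        scaleR_conv_of_real sum_divide_distrib field_simps)
  finally show ?thesis .
qed

lemma integrable_coord:
  fixes g :: "nat \<Rightarrow> 'b::{banach,second_countable_topology}"
  shows "integrable (haar m) (\<lambda>x. g (x i))"
proof (rule integrable_const_bound)
  show "AE x in haar m. norm (g (x i)) \<le> (\<Sum>t<m i. norm (g t))"
  proof (rule AE_I2)
    fix x assume "x \<in> space (haar m)"
    then show "norm (g (x i)) \<le> (\<Sum>t<m i. norm (g t))"
      by (intro member_le_sum) (auto simp: space_haar)
  qed
qed (rule measurable_coord_fun)

text \<open>Independence of the coordinates reduces such integrals to finite sums. The value type is
  left general to cover real indicators as well as complex characters.\<close>

lemma integral_prod_coord:
  fixes g :: "nat \<Rightarrow> nat \<Rightarrow> 'b::{real_normed_field,banach,second_countable_topology}"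
  shows "(LINT x|haar m. (\<Prod>i<K. g i (x i))) = (\<Prod>i<K. (\<Sum>t<m i. g i t) / of_nat (m i))"
proof -
  have "indep_vars (\<lambda>_. borel) (\<lambda>i x. g i (x i)) {..<K}"
    by (rule indep_vars_compose2[OF indep_vars_subset[OF indep_coords subset_UNIV]])
       (rule borel_measurable_uniform_count_measure)
  then show ?thesis
    by (subst indep_vars_lebesgue_integral) (auto simp: integral_coord integrable_coord)
qed

section \<open>The numbers \<open>M k\<close> and the neighbourhoods of zero\<close>

abbreviation M :: "nat \<Rightarrow> nat" where "M \<equiv> vilenkin_M m"

lemma M_eq_prod: "M k = (\<Prod>i<k. m i)"
  by (induction k) (auto simp: mult.commute)

lemma M_pos: "0 < M k"
  using vilenkin_M_gt[of m k, OF m_ge_2] by simp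

lemma M_dvd: "s \<le> N \<Longrightarrow> M s dvd M N"
  by (induction rule: dec_induct) auto

lemma M_double: "2 * M k \<le> M (Suc k)"
  using m_ge_2[of k] by simp

lemma M_double_le: "i < j \<Longrightarrow> 2 * M i \<le> M j"
  by (rule order_trans[OF M_double dvd_imp_le[OF M_dvd M_pos]]) simp

definition zeros :: "nat \<Rightarrow> (nat \<Rightarrow> nat) set" where
  "zeros s = {x \<in> space (haar m). \<forall>i<s. x i = 0}"

lemma zeros_sets [measurable]: "zeros s \<in> sets (haar m)"
proof -
  have "zeros s = space (haar m) \<inter> (\<Inter>i\<in>{..<s}. {y \<in> space (haar m). y i = 0})"
    by (auto simp: zeros_def)
  also have "\<dots> \<in> sets (haar m)"
    using measurable_coord by (cases "s = 0") (auto intro!: sets.Int sets.finite_INT)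
  finally show ?thesis .
qed

lemma measure_zeros: "measure (haar m) (zeros s) = 1 / M s"
proof -
  have "measure (haar m) (zeros s) = (LINT x|haar m. indicator (zeros s) x)"
    by simp
  also have "\<dots> = (LINT x|haar m. (\<Prod>i<s. of_bool (x i = 0) :: real))"
    by (rule Bochner_Integration.integral_cong)
       (auto simp: zeros_def indicator_def prod_of_bool)
  also have "\<dots> = (\<Prod>i<s. 1 / real (m i))"
    using m_pos by (subst integral_prod_coord) (auto intro!: prod.cong simp: of_bool_def)
  also have "\<dots> = 1 / M s"
    by (simp add: M_eq_prod prod_dividef)
  finally show ?thesis .
qed

lemma integrable_zeros: "integrable (haar m) (indicator (zeros s) :: _ \<Rightarrow> real)"
  by (rule integrable_real_indicator) (auto simp: emeasure_eq_measure)

text \<open>The zero sequence lies in every \<open>zeros s\<close>, and these sets have measure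
  \<open>1 / M s\<close>, which tends to 0. This null set is where the series of atoms below may
  diverge.\<close>

lemma AE_not_zeros: "AE x in haar m. \<exists>i. x i \<noteq> 0"
proof -
  let ?Z = "\<Inter>s. zeros s"
  have "measure (haar m) ?Z \<le> 1 / real (Suc s)" for s
  proof -
    have "measure (haar m) ?Z \<le> measure (haar m) (zeros s)"
      by (rule finite_measure_mono) auto
    also have "\<dots> \<le> 1 / real (Suc s)"
      unfolding measure_zeros using vilenkin_M_gt[of m s, OF m_ge_2]
      by (intro divide_left_mono) auto
    finally show ?thesis .
  qed
  then have "measure (haar m) ?Z \<le> 0"
    by (metis LIMSEQ_le_const LIMSEQ_inverse_real_of_nat inverse_eq_divide)
  then have "measure (haar m) ?Z = 0"
    using measure_nonneg by (rule order_antisym)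
  then have "emeasure (haar m) ?Z = 0"
    by (simp add: emeasure_eq_measure)
  then have "AE x in haar m. x \<notin> ?Z"
    by (intro AE_not_in) (auto simp: null_sets_def)
  then show ?thesis
    by (rule AE_mp) (auto simp: zeros_def intro!: AE_I2)
qed

section \<open>Characters\<close>

lemma norm_rademacher [simp]: "norm (rademacher m i x) = 1"
  by (simp add: rademacher_def norm_exp_eq_Re)

lemma rademacher_root: "x i < m i \<Longrightarrow> rademacher m i x ^ m i = 1"
  using m_pos[of i] complex_root_unity[of "m i" "x i"] by (simp add: rademacher_def mult_ac)

text \<open>Orthogonality of the characters of one factor: the summands are powers of a root of
  unity \<open>?w\<close>, and the geometric sum vanishes unless \<open>?w = 1\<close>.\<close>

lemma sum_rademacher:
  assumes "a < m i" "b < m i"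
  shows "(\<Sum>t<m i. rademacher m i (\<lambda>_. t) ^ a * cnj (rademacher m i (\<lambda>_. t) ^ b))
    = (if a = b then of_nat (m i) else 0)"
proof -
  let ?q = "m i"
  \<comment> \<open>A natural number congruent to \<open>a - b\<close> modulo \<open>?q\<close>. It
    lies strictly between 0 and \<open>2 * ?q\<close>, so it is divisible by \<open>?q\<close> only
    if \<open>a = b\<close>.\<close>
  let ?j = "a + (?q - b)"
  let ?w = "exp (2 * of_real pi * \<i> * of_nat ?j / of_nat ?q)"
  have summand: "rademacher m i (\<lambda>_. t) ^ a * cnj (rademacher m i (\<lambda>_. t) ^ b) = ?w ^ t"
    if t: "t < ?q" for t
  proof -
    let ?r = "rademacher m i (\<lambda>_. t)"
    have r: "?r * cnj ?r = 1" 
      by (simp add: complex_norm_square[symmetric])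
    \<comment> \<open>Inserting \<open>?r ^ ?q = 1\<close> lets \<open>b\<close> of its factors
      cancel against the conjugates.\<close>
    have "cnj ?r ^ b = ?r ^ ?q * cnj ?r ^ b"
      using t by (simp add: rademacher_root)
    also have "\<dots> = ?r ^ (?q - b) * (?r * cnj ?r) ^ b"
      using assms by (simp add: power_mult_distrib power_add[symmetric] flip: mult.assoc)
    finally have "?r ^ a * cnj (?r ^ b) = ?r ^ ?j"
      using r by (simp add: power_add)
    also have "\<dots> = ?w ^ t"
      by (simp add: rademacher_def exp_of_nat_mult[symmetric] mult_ac)
    finally show ?thesis .
  qed
  have sum: "(\<Sum>t<?q. rademacher m i (\<lambda>_. t) ^ a * cnj (rademacher m i (\<lambda>_. t) ^ b)) = (\<Sum>t<?q. ?w ^ t)"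
    using summand by (intro sum.cong) auto
  have w1: "?w = 1 \<longleftrightarrow> ?q dvd ?j"
    using m_pos[of i] by (intro complex_root_unity_eq_1) simp
  have dvd: "?q dvd ?j \<longleftrightarrow> a = b"
  proof
    assume "?q dvd ?j"
    then obtain c where c: "?j = ?q * c" by (elim dvdE)
    moreover have "0 < ?j" "?j < ?q * 2" using assms by auto
    ultimately have "0 < c" "c < 2" by (auto simp del: add_gr_0)
    then have "c = 1" by simp
    with c assms show "a = b" by simp
  qed (use assms in simp)
  show ?thesis
  proof (cases "a = b")
    case True
    then have "?w = 1" using w1 dvd by blast
    then show ?thesis unfolding sum using True by simp
  next
    case False
    then have "?w \<noteq> 1" using w1 dvd by blast
    moreover have "?w ^ ?q = 1"
      using complex_root_unity[of ?q ?j] m_pos[of i] by simp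
    ultimately show ?thesis unfolding sum using False by (simp add: geometric_sum)
  qed
qed

lemma digit_less_m: "digit m n j < m j"
  by (rule digit_less) (rule m_ge_2)

text \<open>The freedom in \<open>K\<close> allows characters of different indices to be written
  over one common range.\<close>

lemma psi_eq_prod:
  assumes "n \<le> K"
  shows "vilenkin_psi m n x = (\<Prod>i<K. rademacher m i x ^ digit m n i)"
  unfolding vilenkin_psi_def
  using digits_subset[of m n, OF m_ge_2] assms by (intro prod.mono_neutral_left) auto

lemma norm_psi [simp]: "norm (vilenkin_psi m n x) = 1"
  by (simp add: psi_eq_prod[OF order_refl] prod_norm[symmetric] norm_power)

lemma measurable_rademacher [measurable]: "rademacher m i \<in> borel_measurable (haar m)"
  using measurable_coord_fun[of "\<lambda>t. exp (2 * of_real pi * \<i> * of_nat t / of_nat (m i)) :: complex" i]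
  by (simp add: rademacher_def[abs_def])

lemma measurable_psi [measurable]: "vilenkin_psi m n \<in> borel_measurable (haar m)"
proof -
  have "(\<lambda>x. \<Prod>i<n. rademacher m i x ^ digit m n i) \<in> borel_measurable (haar m)"
    by measurable
  then show ?thesis
    by (simp add: psi_eq_prod[OF order_refl, abs_def])
qed

lemma digit_cong_div:
  assumes "k div M s = l div M s" "s \<le> i"
  shows "digit m k i = digit m l i"
proof -
  obtain c where c: "M i = M s * c"
    using M_dvd[OF assms(2)] by (elim dvdE)
  show ?thesis
    using assms(1) by (simp add: digit_def c div_mult2_eq)
qed

text \<open>On \<open>zeros s\<close> the factors below \<open>s\<close> equal 1, and the digits
  from \<open>s\<close> on depend only on the quotient by \<open>M s\<close>.\<close>

lemma psi_cong_div:
  assumes "x \<in> zeros s" "k div M s = l div M s"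
  shows "vilenkin_psi m k x = vilenkin_psi m l x"
proof -
  have "vilenkin_psi m k x = (\<Prod>i<max k l. rademacher m i x ^ digit m k i)"
    by (rule psi_eq_prod) simp
  also have "\<dots> = (\<Prod>i<max k l. rademacher m i x ^ digit m l i)"
  proof (intro prod.cong refl)
    fix i
    show "rademacher m i x ^ digit m k i = rademacher m i x ^ digit m l i"
    proof (cases "i < s")
      case True
      then show ?thesis using assms(1) by (simp add: zeros_def rademacher_def)
    next
      case False
      then show ?thesis using digit_cong_div[OF assms(2), of i] by simp
    qed
  qed
  also have "\<dots> = vilenkin_psi m l x"
    by (rule psi_eq_prod[symmetric]) simp
  finally show ?thesis .
qed

section \<open>Atoms with constant Fourier coefficients\<close>

definition hump :: "nat \<Rightarrow> (nat \<Rightarrow> nat) \<Rightarrow> complex" where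
  "hump N x = of_nat (M N) * indicator (zeros N) x * rademacher m N x"

lemma measurable_hump [measurable]: "hump N \<in> borel_measurable (haar m)"
  unfolding hump_def[abs_def] by measurable

lemma norm_hump: "norm (hump N x) = real (M N) * indicator (zeros N) x"
  by (simp add: hump_def norm_mult indicator_def)

text \<open>The integrand factors over the coordinates. Those below \<open>N\<close> contribute
  \<open>1 / m i\<close> each, which cancels the factor \<open>M N\<close>; the others are evaluated
  by orthogonality. The condition on the digits says that \<open>k\<close> lies in
  \<open>[M N, 2 * M N)\<close>.\<close>

lemma fourier_coeff_hump:
  "fourier_coeff m (hump N) k = of_bool (\<forall>i\<ge>N. digit m k i = of_bool (i = N))"
proof -
  \<comment> \<open>Large enough to include coordinate \<open>N\<close> and every nonzero digit of
    \<open>k\<close>.\<close>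
  define K where "K = Suc (max k N)"
  \<comment> \<open>The test \<open>t = 0\<close> for \<open>i < N\<close> encodes the indicator of
    \<open>zeros N\<close>, and the exponent \<open>of_bool (i = N)\<close> places the Rademacher
    factor in coordinate \<open>N\<close> alone.\<close>
  define g where "g i t = (if i < N \<longrightarrow> t = 0
      then rademacher m i (\<lambda>_. t) ^ of_bool (i = N) * cnj (rademacher m i (\<lambda>_. t) ^ digit m k i)
      else 0)" for i t
  have g_coord: "g i (x i) = (if i < N \<longrightarrow> x i = 0
      then rademacher m i x ^ of_bool (i = N) * cnj (rademacher m i x ^ digit m k i)
      else 0)" for i x
    by (simp add: g_def rademacher_def)
  have "hump N x * cnj (vilenkin_psi m k x) = of_nat (M N) * (\<Prod>i<K. g i (x i))"
    if x: "x \<in> space (haar m)" for x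
  proof (cases "x \<in> zeros N")
    case True
    then have "(\<Prod>i<K. g i (x i)) = (\<Prod>i<K. rademacher m i x ^ of_bool (i = N))
        * cnj (\<Prod>i<K. rademacher m i x ^ digit m k i)"
      unfolding g_coord prod.distrib[symmetric] cnj_prod
      by (intro prod.cong) (auto simp: zeros_def)
    also have "(\<Prod>i<K. rademacher m i x ^ of_bool (i = N))
        = (\<Prod>i<K. if i = N then rademacher m i x else 1)"
      by (intro prod.cong) auto
    also have "\<dots> = rademacher m N x"
      by (simp add: K_def)
    also have "(\<Prod>i<K. rademacher m i x ^ digit m k i) = vilenkin_psi m k x"
      by (rule psi_eq_prod[symmetric]) (simp add: K_def)
    finally show ?thesis
      using True by (simp add: hump_def)
  next
    case False
    then obtain i where "i < N" "x i \<noteq> 0"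
      using x by (auto simp: zeros_def)
    then have "i \<in> {..<K}" "g i (x i) = 0"
      by (auto simp: K_def g_coord)
    then have "(\<Prod>i<K. g i (x i)) = 0"
      by (intro prod_zero) auto
    then show ?thesis
      using False by (simp add: hump_def)
  qed
  then have "fourier_coeff m (hump N) k = (LINT x|haar m. of_nat (M N) * (\<Prod>i<K. g i (x i)))"
    unfolding fourier_coeff_def by (intro Bochner_Integration.integral_cong) auto
  also have "\<dots> = of_nat (M N) * (\<Prod>i<K. (\<Sum>t<m i. g i t) / of_nat (m i))"
    by (simp add: integral_prod_coord)
  also have "(\<Prod>i<K. (\<Sum>t<m i. g i t) / of_nat (m i))
     = (\<Prod>i<K. (if i < N then 1 / of_nat (m i) else 1) * of_bool (N \<le> i \<longrightarrow> digit m k i = of_bool (i = N)))"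
  proof (intro prod.cong refl)
    fix i
    show "(\<Sum>t<m i. g i t) / of_nat (m i) = (if i < N then 1 / of_nat (m i) else 1)
        * of_bool (N \<le> i \<longrightarrow> digit m k i = of_bool (i = N))"
    proof (cases "i < N")
      case True
      then have "(\<Sum>t<m i. g i t) = (\<Sum>t<m i. if t = 0 then 1 else 0)"
        by (intro sum.cong) (auto simp: g_def rademacher_def)
      then show ?thesis
        using True m_pos[of i] by simp
    next
      case False
      then have "(\<Sum>t<m i. g i t) = (\<Sum>t<m i. rademacher m i (\<lambda>_. t) ^ of_bool (i = N)
          * cnj (rademacher m i (\<lambda>_. t) ^ digit m k i))"
        by (simp add: g_def)
      also have "\<dots> = (if of_bool (i = N) = digit m k i then of_nat (m i) else 0)"
        using m_ge_2[of i] by (intro sum_rademacher digit_less_m) auto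
      finally show ?thesis
        using False m_pos[of i] by auto
    qed
  qed
  also have "\<dots> = (\<Prod>i<K. if i < N then 1 / of_nat (m i) else 1)
      * (\<Prod>i<K. of_bool (N \<le> i \<longrightarrow> digit m k i = of_bool (i = N)))"
    by (rule prod.distrib)
  also have "(\<Prod>i<K. if i < N then 1 / of_nat (m i) else 1) = (\<Prod>i<N. 1 / of_nat (m i) :: complex)"
    by (rule prod.mono_neutral_cong_right) (auto simp: K_def)
  also have "\<dots> = 1 / of_nat (M N)"
    by (simp add: M_eq_prod prod_dividef)
  also have "(\<Prod>i<K. of_bool (N \<le> i \<longrightarrow> digit m k i = of_bool (i = N)))
      = (of_bool (\<forall>i\<ge>N. digit m k i = of_bool (i = N)) :: complex)"
  proof -
    have "digit m k i = of_bool (i = N)" if "K \<le> i" for i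
      using that digit_eq_0[of m k i, OF m_ge_2] by (simp add: K_def)
    then have "(\<forall>i<K. N \<le> i \<longrightarrow> digit m k i = of_bool (i = N)) \<longleftrightarrow> (\<forall>i\<ge>N. digit m k i = of_bool (i = N))"
      by (meson not_le_imp_less)
    then show ?thesis
      by (simp only: prod_of_bool)
  qed
  finally show ?thesis
    using M_pos[of N] by simp
qed

text \<open>The spectra of distinct humps are disjoint: an index in this block has leading digit 1
  exactly at position \<open>N\<close>.\<close>

lemma fourier_coeff_hump_block:
  assumes "M N \<le> k" "k < 2 * M N"
  shows "fourier_coeff m (hump N') k = of_bool (N' = N)"
proof -
  have N: "digit m k N = 1"
  proof -
    have "k div M N = 1"
      using assms by (intro div_nat_eqI) auto
    then show ?thesis
      using m_ge_2[of N] by (simp add: digit_def)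
  qed
  have gt: "digit m k i = 0" if "N < i" for i
    using M_double_le[OF that] assms by (simp add: digit_def)
  have "(\<forall>i\<ge>N'. digit m k i = of_bool (i = N')) \<longleftrightarrow> N' = N"
  proof
    assume *: "\<forall>i\<ge>N'. digit m k i = of_bool (i = N')"
    show "N' = N"
      using * N gt[of N'] by (metis linorder_not_le nless_le of_bool_eq(1) of_bool_eq(2) zero_neq_one)
  qed (use N gt in auto)
  then show ?thesis
    by (simp add: fourier_coeff_hump)
qed

lemma interval_zeros: "interval m (zeros N)"
proof -
  have "(\<lambda>_. 0) \<in> space (haar m)"
    using m_pos by (simp add: space_haar)
  moreover have "zeros N = (\<Union>k\<in>{..<m N}. cell m N (\<lambda>_. 0) k)"
    by (auto simp: zeros_def cell_def space_haar)
  ultimately show ?thesis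
    unfolding interval_def using dyadic_blocks.whole[of "m N"] by blast
qed

text \<open>The integral is the coefficient of index 0, whose digit at \<open>N\<close> is 0 rather
  than 1.\<close>

lemma integral_hump: "(LINT x|haar m. hump N x) = 0"
proof -
  have "vilenkin_psi m 0 x = 1" for x
    by (simp add: vilenkin_psi_def digit_def)
  then have "(LINT x|haar m. hump N x) = fourier_coeff m (hump N) 0"
    by (simp add: fourier_coeff_def)
  also have "\<dots> = 0"
    by (auto simp: fourier_coeff_hump digit_def)
  finally show ?thesis .
qed

lemma atom_hump: "atom m (hump N)"
proof -
  have "(LINT x:zeros N|haar m. hump N x) = (LINT x|haar m. hump N x)"
    unfolding set_lebesgue_integral_def
    by (intro Bochner_Integration.integral_cong) (auto simp: hump_def indicator_def)
  then have "(LINT x:zeros N|haar m. hump N x) = 0"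
    by (simp add: integral_hump)
  moreover have "hump N \<in> L_infinity m"
    unfolding L_infinity_def by (auto simp: norm_hump indicator_def intro!: exI[of _ "M N"])
  moreover have "AE x in haar m. x \<notin> zeros N \<longrightarrow> hump N x = 0"
    by (simp add: hump_def)
  moreover have "AE x in haar m. norm (hump N x) \<le> 1 / measure (haar m) (zeros N)"
    by (simp add: norm_hump measure_zeros indicator_def)
  ultimately show ?thesis
    unfolding atom_def using interval_zeros by blast
qed

lemma integrable_hump: "integrable (haar m) (hump N)"
  by (rule integrable_const_bound[where B = "M N"]) (auto simp: norm_hump indicator_def)

lemma integral_norm_hump: "(LINT x|haar m. norm (hump N x)) = 1"
  using M_pos[of N] by (simp add: norm_hump measure_zeros)

section \<open>Lower bound for averages of partial sums\<close>

text \<open>The added indices share the quotient \<open>P\<close> by \<open>M s\<close>, so their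
  characters agree at \<open>x\<close>, and the bounds on \<open>P\<close> keep them where the
  coefficient is \<open>c\<close>.\<close>

lemma partial_sum_block:
  assumes coeff: "\<And>l. \<lbrakk>M N \<le> l; l < 2 * M N\<rbrakk> \<Longrightarrow> fourier_coeff m f l = c"
    and x: "x \<in> zeros s" and P: "M N \<le> P * M s" "P * M s + M s \<le> 2 * M N" and "A \<le> M s"
  shows "partial_sum m (P * M s + A) f x
    = partial_sum m (P * M s) f x + of_nat A * (c * vilenkin_psi m (P * M s) x)"
  using \<open>A \<le> M s\<close>
proof (induction A)
  case (Suc A)
  have "(P * M s + A) div M s = (P * M s) div M s"
    using Suc.prems by simp
  then have "vilenkin_psi m (P * M s + A) x = vilenkin_psi m (P * M s) x"
    using x by (intro psi_cong_div)
  moreover have "fourier_coeff m f (P * M s + A) = c"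
    using P Suc.prems by (intro coeff) auto
  moreover have "partial_sum m (P * M s + Suc A) f x = partial_sum m (P * M s + A) f x
      + fourier_coeff m f (P * M s + A) * vilenkin_psi m (P * M s + A) x"
    by (simp add: partial_sum_def)
  ultimately show ?case
    using Suc by (simp add: algebra_simps)
qed simp

text \<open>The range splits into \<open>M N / M s\<close> blocks of length \<open>M s\<close>, on
  each of which the partial sums are affine in the index and \<open>sum_norm_affine_ge\<close>
  applies.\<close>

lemma sum_norm_partial_sum_ge:
  assumes coeff: "\<And>l. \<lbrakk>M N \<le> l; l < 2 * M N\<rbrakk> \<Longrightarrow> fourier_coeff m f l = c"
    and x: "x \<in> zeros s" and s: "1 \<le> s" "s \<le> N"
  shows "norm c * M N * M s / 9 \<le> (\<Sum>k\<in>{M N..<2 * M N}. norm (partial_sum m k f x))"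
proof -
  obtain q where q: "M N = q * M s"
    using M_dvd[OF s(2)] by (metis dvd_def mult.commute)
  \<comment> \<open>The affine bound needs two terms per block, hence
    \<open>1 \<le> s\<close>.\<close>
  have M2: "2 \<le> M s"
    using M_double_le[of 0 s] s(1) by simp
  let ?g = "\<lambda>k. norm (partial_sum m k f x)"
  have "norm c * M N * M s / 9 = (\<Sum>j<q. (real (M s))\<^sup>2 / 9 * norm c)"
    by (simp add: q power2_eq_square)
  also have "\<dots> \<le> (\<Sum>j<q. \<Sum>A<M s. ?g ((q + j) * M s + A))"
  proof (rule sum_mono)
    fix j assume "j \<in> {..<q}"
    then have "(j + 1) * M s \<le> M N"
      unfolding q by (intro mult_le_mono1) simp
    then have P: "M N \<le> (q + j) * M s" "(q + j) * M s + M s \<le> 2 * M N"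
      unfolding q by (simp_all add: algebra_simps)
    let ?v = "c * vilenkin_psi m ((q + j) * M s) x"
    have "(real (M s))\<^sup>2 / 9 * norm c = (real (M s))\<^sup>2 / 9 * norm ?v"
      by (simp add: norm_mult)
    also have "\<dots> \<le> (\<Sum>A<M s. norm (partial_sum m ((q + j) * M s) f x + of_nat A * ?v))"
      by (rule sum_norm_affine_ge[OF M2])
    also have "\<dots> = (\<Sum>A<M s. ?g ((q + j) * M s + A))"
      by (intro sum.cong refl) (simp add: partial_sum_block[OF coeff x P])
    finally show "(real (M s))\<^sup>2 / 9 * norm c \<le> (\<Sum>A<M s. ?g ((q + j) * M s + A))" .
  qed
  also have "\<dots> = (\<Sum>j<q. \<Sum>i\<in>{j * M s..<j * M s + M s}. ?g (M N + i))"
    by (simp only: sum_atLeastLessThan_shift q distrib_right add.assoc)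
  also have "\<dots> = (\<Sum>i<M N. ?g (M N + i))"
    unfolding q by (rule sum.nat_group)
  also have "\<dots> = (\<Sum>k\<in>{M N..<M N + M N}. ?g k)"
    by (rule sum_atLeastLessThan_shift[symmetric])
  finally show ?thesis
    by (simp add: mult_2)
qed

lemma sum_M_le: "(\<Sum>s=1..n. M s) \<le> 2 * M n"
proof (induction n)
  case (Suc n)
  have "(\<Sum>s=1..Suc n. M s) = (\<Sum>s=1..n. M s) + M (Suc n)"
    by simp
  also have "\<dots> \<le> 2 * M (Suc n)"
    using Suc M_double[of n] by linarith
  finally show ?case .
qed simp

text \<open>This trades a maximum over \<open>s\<close> for a sum. The sum is controlled by the
  largest \<open>s\<close> with \<open>x\<close> in \<open>zeros s\<close>, since the
  \<open>M s\<close> at least double at each step; if there is no such \<open>s\<close>, then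
  \<open>0 \<le> G\<close> suffices.\<close>

lemma sum_indicator_zeros_le:
  assumes "0 \<le> G" and "\<And>s. \<lbrakk>1 \<le> s; s \<le> n; x \<in> zeros s\<rbrakk> \<Longrightarrow> real (M s) \<le> G"
  shows "(\<Sum>s=1..n. real (M s) * indicator (zeros s) x) \<le> 2 * G"
  using assms(2)
proof (induction n)
  case (Suc n)
  show ?case
  proof (cases "x \<in> zeros (Suc n)")
    case True
    have "(\<Sum>s=1..Suc n. real (M s) * indicator (zeros s) x) \<le> (\<Sum>s=1..Suc n. real (M s))"
      by (intro sum_mono) (auto simp: indicator_def)
    also have "\<dots> = real (\<Sum>s=1..Suc n. M s)"
      by simp
    also have "\<dots> \<le> real (2 * M (Suc n))"
      using sum_M_le by (rule of_nat_mono)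
    also have "\<dots> \<le> 2 * G"
      using Suc.prems[of "Suc n"] True by simp
    finally show ?thesis .
  next
    case False
    then show ?thesis
      using Suc by simp
  qed
qed (use assms(1) in simp)

lemma integrable_partial_sum: "integrable (haar m) (partial_sum m k f)"
proof -
  have "integrable (haar m) (vilenkin_psi m l)" for l
    by (rule integrable_const_bound[where B = 1]) auto
  then have "integrable (haar m) (\<lambda>x. \<Sum>l<k. fourier_coeff m f l * vilenkin_psi m l x)"
    by simp
  then show ?thesis
    by (simp add: partial_sum_def[abs_def])
qed

text \<open>Each \<open>M s * indicator (zeros s)\<close> has integral 1, so integrating the
  pointwise bound yields \<open>N\<close>. The constant 36 combines 9 from the affine bound, 2 from
  the geometric sum and 2 from averaging over \<open>2 * M N\<close> indices.\<close>

lemma average_ge: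
  assumes coeff: "\<And>l. \<lbrakk>M N \<le> l; l < 2 * M N\<rbrakk> \<Longrightarrow> fourier_coeff m f l = c"
  shows "norm c * N / 36
    \<le> 1 / real (2 * M N) * (\<Sum>k=1..2 * M N. L1_norm m (partial_sum m k f))"
proof -
  let ?G = "\<lambda>x. \<Sum>k\<in>{M N..<2 * M N}. norm (partial_sum m k f x)"
  let ?I = "\<lambda>x. \<Sum>s=1..N. real (M s) * indicator (zeros s) x :: real"
  have int_I: "integrable (haar m) ?I"
    by (intro Bochner_Integration.integrable_sum integrable_mult_right integrable_zeros)
  have int_G: "integrable (haar m) ?G"
    by (intro Bochner_Integration.integrable_sum integrable_norm integrable_partial_sum)
  have "norm c * M N / 18 * ?I x \<le> ?G x" for x
  \<comment> \<open>The bound passed to \<open>sum_indicator_zeros_le\<close> is divided by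
    \<open>norm c\<close>.\<close>
  proof (cases "c = 0")
    case False
    have "?I x \<le> 2 * (9 * ?G x / (norm c * M N))"
    proof (rule sum_indicator_zeros_le)
      fix s assume "1 \<le> s" "s \<le> N" "x \<in> zeros s"
      then have "norm c * M N * M s / 9 \<le> ?G x"
        by (intro sum_norm_partial_sum_ge coeff)
      then show "real (M s) \<le> 9 * ?G x / (norm c * M N)"
        using False M_pos[of N] by (simp add: field_simps)
    qed (simp add: sum_nonneg)
    then show ?thesis
      using False M_pos[of N] by (simp add: field_simps)
  qed (simp add: sum_nonneg)
  then have "(LINT x|haar m. norm c * M N / 18 * ?I x) \<le> (LINT x|haar m. ?G x)"
    using int_I int_G by (intro integral_mono) auto
  also have "(LINT x|haar m. norm c * M N / 18 * ?I x) = norm c * M N / 18 * (LINT x|haar m. ?I x)"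
    by (rule Bochner_Integration.integral_mult_right_zero)
  also have "(LINT x|haar m. ?I x) = (\<Sum>s=1..N. real (M s) * measure (haar m) (zeros s))"
    by (subst Bochner_Integration.integral_sum) (auto intro: integrable_zeros)
  also have "\<dots> = N"
    using M_pos by (simp add: measure_zeros less_imp_neq[symmetric])
  also have "(LINT x|haar m. ?G x) = (\<Sum>k\<in>{M N..<2 * M N}. L1_norm m (partial_sum m k f))"
    unfolding L1_norm_def
    by (intro Bochner_Integration.integral_sum integrable_norm integrable_partial_sum)
  also have "\<dots> \<le> (\<Sum>k=1..2 * M N. L1_norm m (partial_sum m k f))"
    using M_pos[of N] by (intro sum_mono2) (auto simp: L1_norm_def)
  finally show ?thesis
    using M_pos[of N] by (simp add: field_simps)
qed

section \<open>Superposition of atoms\<close>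

definition hump_term :: "nat \<Rightarrow> (nat \<Rightarrow> nat) \<Rightarrow> complex" where
  "hump_term j x = (1 / 2) ^ j * hump (4 ^ j) x"

text \<open>The value of \<open>suminf\<close> where the series diverges is immaterial, as this
  happens only on a null set.\<close>

definition hump_series :: "(nat \<Rightarrow> nat) \<Rightarrow> complex" where
  "hump_series x = (\<Sum>j. hump_term j x)"

lemma integrable_hump_term: "integrable (haar m) (hump_term j)"
  unfolding hump_term_def[abs_def] by (intro integrable_mult_right integrable_hump)

lemma measurable_hump_term [measurable]: "hump_term j \<in> borel_measurable (haar m)"
  using integrable_hump_term by (rule borel_measurable_integrable)

lemma integral_norm_hump_term: "(LINT x|haar m. norm (hump_term j x)) = (1 / 2) ^ j"
  by (simp add: hump_term_def norm_mult norm_power integral_norm_hump)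

text \<open>If \<open>x i\<close> is nonzero, then \<open>x\<close> lies outside
  \<open>zeros (4 ^ j)\<close> for all \<open>j > i\<close>, so only finitely many terms
  survive.\<close>

lemma AE_summable_hump_term: "AE x in haar m. summable (\<lambda>j. norm (hump_term j x))"
  using AE_not_zeros
proof eventually_elim
  case (elim x)
  then obtain i where i: "x i \<noteq> 0" ..
  have "norm (hump_term j x) = 0" if "j \<notin> {..i}" for j
  proof -
    have "i < j"
      using that by simp
    also have "j < 4 ^ j"
      by (rule power_gt_expt) simp
    finally have "i < 4 ^ j" .
    then show ?thesis
      using i by (auto simp: hump_term_def hump_def zeros_def indicator_def)
  qed
  then show ?case
    by (intro summable_finite[of "{..i}"]) auto
qed

lemma summable_half: "summable (\<lambda>j. (1 / 2) ^ j :: real)"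
  by (rule summable_geometric) simp

lemma integrable_hump_series: "integrable (haar m) hump_series"
  unfolding hump_series_def[abs_def]
  by (rule integrable_suminf[OF integrable_hump_term AE_summable_hump_term])
     (simp add: integral_norm_hump_term summable_half)

text \<open>Termwise integration is justified by the summable L1 norms; disjointness of the spectra
  then leaves only the term \<open>j\<close>.\<close>

lemma fourier_coeff_hump_series:
  assumes "M (4 ^ j) \<le> k" "k < 2 * M (4 ^ j)"
  shows "fourier_coeff m hump_series k = (1 / 2) ^ j"
proof -
  let ?F = "\<lambda>i x. hump_term i x * cnj (vilenkin_psi m k x)"
  have [measurable]: "(\<lambda>x. cnj (vilenkin_psi m k x)) \<in> borel_measurable (haar m)"
    by (rule borel_measurable_continuous_on[OF _ measurable_psi]) (intro continuous_intros)
  have [measurable]: "hump_series \<in> borel_measurable (haar m)"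
    using integrable_hump_series by (rule borel_measurable_integrable)
  have norm_F: "norm (?F i x) = norm (hump_term i x)" for i x
    by (simp add: norm_mult)
  have int_F: "integrable (haar m) (?F i)" for i
    by (rule Bochner_Integration.integrable_bound[OF integrable_hump_term[of i]]) (auto simp: norm_mult)
  have sum_F: "AE x in haar m. summable (\<lambda>i. norm (?F i x))"
    unfolding norm_F by (rule AE_summable_hump_term)
  have sum_int_F: "summable (\<lambda>i. LINT x|haar m. norm (?F i x))"
    by (simp add: norm_F integral_norm_hump_term summable_half)
  have "fourier_coeff m hump_series k = (LINT x|haar m. (\<Sum>i. ?F i x))"
    unfolding fourier_coeff_def
  proof (rule integral_cong_AE)
    show "AE x in haar m. hump_series x * cnj (vilenkin_psi m k x) = (\<Sum>i. ?F i x)"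
      using AE_summable_hump_term
      by eventually_elim (simp add: hump_series_def suminf_mult2[OF summable_norm_cancel])
  qed measurable
  also have "\<dots> = (\<Sum>i. LINT x|haar m. ?F i x)"
    by (rule integral_suminf[OF int_F sum_F sum_int_F])
  also have "\<dots> = (\<Sum>i. (1 / 2) ^ i * fourier_coeff m (hump (4 ^ i)) k)"
    by (simp add: fourier_coeff_def hump_term_def mult.assoc)
  also have "\<dots> = (\<Sum>i. if i = j then (1 / 2) ^ i else 0)"
    by (intro suminf_cong) (simp add: fourier_coeff_hump_block[OF assms])
  also have "\<dots> = (1 / 2) ^ j"
    by (subst suminf_finite[of "{j}"]) auto
  finally show ?thesis .
qed

lemma hump_series_in_H1: "hump_series \<in> H1 m"
proof -
  \<comment> \<open>An integrable majorant of all tails of the series, for dominated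
    convergence.\<close>
  let ?w = "\<lambda>x. \<Sum>j. norm (hump_term j x)"
  have int_w: "integrable (haar m) ?w"
  proof (rule integrable_suminf)
    show "integrable (haar m) (\<lambda>x. norm (hump_term j x))" for j
      by (intro integrable_norm integrable_hump_term)
  qed (simp_all add: AE_summable_hump_term integral_norm_hump_term summable_half)
  have [measurable]: "hump_series \<in> borel_measurable (haar m)"
    using integrable_hump_series by (rule borel_measurable_integrable)
  have "(\<lambda>n. LINT x|haar m. norm (hump_series x - (\<Sum>j<n. hump_term j x)))
      \<longlonglongrightarrow> (LINT x|haar m. 0)"
  proof (rule integral_dominated_convergence[OF _ _ int_w])
    show "AE x in haar m. (\<lambda>n. norm (hump_series x - (\<Sum>j<n. hump_term j x))) \<longlonglongrightarrow> 0"
      using AE_summable_hump_term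
    proof eventually_elim
      case (elim x)
      then have "(\<lambda>n. \<Sum>j<n. hump_term j x) \<longlonglongrightarrow> hump_series x"
        unfolding hump_series_def by (rule summable_LIMSEQ[OF summable_norm_cancel])
      from tendsto_norm[OF tendsto_diff[OF tendsto_const[of "hump_series x"] this]]
      show ?case by simp
    qed
    show "AE x in haar m. norm (norm (hump_series x - (\<Sum>j<n. hump_term j x))) \<le> ?w x" for n
      using AE_summable_hump_term
    proof eventually_elim
      case (elim x)
      have "hump_series x - (\<Sum>j<n. hump_term j x) = (\<Sum>j. hump_term (j + n) x)"
        unfolding hump_series_def using elim
        by (rule suminf_minus_initial_segment[OF summable_norm_cancel, symmetric])
      also have "norm \<dots> \<le> (\<Sum>j. norm (hump_term (j + n) x))"
        using summable_ignore_initial_segment[OF elim] by (rule summable_norm)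
      also have "\<dots> \<le> ?w x"
        using suminf_split_initial_segment[OF elim, of n] by (simp add: sum_nonneg)
      finally show ?case by simp
    qed
  qed measurable
  then have "(\<lambda>n. L1_norm m (\<lambda>x. hump_series x - (\<Sum>j<n. (1 / 2) ^ j * hump (4 ^ j) x))) \<longlonglongrightarrow> 0"
    by (simp add: L1_norm_def hump_term_def)
  moreover have "summable (\<lambda>j. norm ((1 / 2) ^ j :: complex))"
    by (simp add: norm_power norm_divide summable_half)
  ultimately show ?thesis
    unfolding H1_def using integrable_hump_series atom_hump
    by (intro CollectI conjI exI[of _ "\<lambda>j. (1 / 2) ^ j"] exI[of _ "\<lambda>j. hump (4 ^ j)"]) auto
qed

lemma SUP_average_hump_series:
  "(SUP n\<in>{1..}. ereal (1 / real n * (\<Sum>k=1..n. L1_norm m (partial_sum m k hump_series)))) = \<infinity>"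
proof (rule SUP_PInfty)
  fix K :: nat
  \<comment> \<open>The 36 absorbs the constant of \<open>average_ge\<close>, where weight times
    level is \<open>(1 / 2) ^ j * 4 ^ j = 2 ^ j\<close>.\<close>
  obtain j :: nat where j: "real (36 * K) \<le> 2 ^ j"
    using real_arch_pow[of 2 "real (36 * K)"] by (auto intro: less_imp_le)
  have "real K \<le> 2 ^ j / 36"
    using j by simp
  also have "(2::real) ^ j = norm ((1 / 2 :: complex) ^ j) * real (4 ^ j)"
    by (simp add: norm_power norm_divide power_mult_distrib[symmetric])
  also have "\<dots> / 36 \<le> 1 / real (2 * M (4 ^ j))
      * (\<Sum>k=1..2 * M (4 ^ j). L1_norm m (partial_sum m k hump_series))"
    by (rule average_ge) (rule fourier_coeff_hump_series)
  finally have "ereal (real K) \<le> ereal (1 / real (2 * M (4 ^ j))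
      * (\<Sum>k=1..2 * M (4 ^ j). L1_norm m (partial_sum m k hump_series)))"
    by simp
  moreover have "2 * M (4 ^ j) \<in> {1..}"
    using M_pos[of "4 ^ j"] by simp
  ultimately show "\<exists>n\<in>{1..}. ereal (real K)
      \<le> ereal (1 / real n * (\<Sum>k=1..n. L1_norm m (partial_sum m k hump_series)))"
    by blast
qed

end

theorem corollary1:
  fixes m :: "nat \<Rightarrow> nat"
  assumes "\<And>k. 2 \<le> m k"
  shows "\<exists>f\<in>H1 m.
    (SUP n\<in>{1..}. ereal (1 / real n * (\<Sum>k=1..n. L1_norm m (partial_sum m k f)))) = \<infinity>"
proof -
  interpret vilenkin m
    by unfold_locales (rule assms)
  show ?thesis
    using hump_series_in_H1 SUP_average_hump_series by blast
qed

end
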